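(* Let $f:\mathbb{R}^n\to\mathbb{R}$ be bounded and continuously differentiable, and let the sequence $\{x_k\}_{k\ge0}$ be generated by Algorithm NMLS (described in the context) applied to $f$, with either of the two choices (V1), (V2) of the nonmonotone term $T_k$. Assume: 1. the level set $L(x_0)=\{x\in\mathbb{R}^n : f(x)\le f(x_0)\}$ is bounded; 2. there are an open convex set $C\supseteq L(x_0)$ and a constant $L>0$ such that $\|\nabla f(x)-\nabla f(y)\|\le L\|x-y\|$ for all $x,y\in C$; 3. there are constants $0<c_1<1<c_2$ such that $g_k^Td_k\le -c_1\|g_k\|^2$ and $\|d_k\|\le c_2\|g_k\|$ for all $k\in\mathbb{N}\cup\{0\}$. Then $$\lim_{k\to\infty}\|g_k\|=0.$$ Furthermore, no limit point of the sequence $\{x_k\}$ is a local maximum of $f$.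
   Context: Notation: $f_k=f(x_k)$, $g_k=\nabla f(x_k)$, $\|\cdot\|$ is the Euclidean norm. Parameters: $x_0\in\mathbb{R}^n$, $\rho\in(0,1)$, $\sigma\in(0,\tfrac12)$, $s\in(0,1]$, an integer $N\ge 1$, and an arbitrary sequence of weights $\eta_k\in[0,1)$, $k\ge 0$. Max-type term: $f_{l(k)}=\max_{0\le j\le m(k)} f_{k-j}$, where $m(0)=0$ and $0\le m(k)\le\min\{m(k-1)+1,N\}$ are integers. Averaged term: $\overline{T}_0=f_0$; for $1\le k<N$, $\overline{T}_k=(1-\eta_{k-1})f_k+\eta_{k-1}\overline{T}_{k-1}$; and for $k\ge N$, $$\overline{T}_k=(1-\eta_{k-1})f_k+\eta_{k-1}(1-\eta_{k-2})f_{k-1}+\cdots+\eta_{k-1}\cdots\eta_{k-N+1}(1-\eta_{k-N})f_{k-N+1}+\eta_{k-1}\cdots\eta_{k-N}f_{k-N},$$ that is, $\overline{T}_k=\sum_{j=0}^{N-1}\Big(\prod_{i=1}^{j}\eta_{k-i}\Big)(1-\eta_{k-j-1})f_{k-j}+\Big(\prod_{i=1}^{N}\eta_{k-i}\Big)f_{k-N}$. Nonmonotone term $T_k$: $T_0=f_0$, and for $k\ge 1$ one of the following two choices is used (the same choice for all $k$): (V1) $T_k=f_k+\eta_{k-1}(\overline{T}_{k-1}-f_k)$ if $k<N$, and $T_k=\max\{\overline{T}_k,f_k\}$ if $k\ge N$; (V2) $T_k=f_{l(k)}$ if $k<N$, and $T_k=\max\{\overline{T}_k,f_k\}$ if $k\ge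 N$. Algorithm NMLS: for $k=0,1,2,\dots$, choose a descent direction $d_k\in\mathbb{R}^n$, i.e. $g_k^Td_k<0$ (so in particular $g_k\neq 0$ for every $k$); let $\alpha_k$ be the largest $\alpha\in\{s,\rho s,\rho^2 s,\dots\}$ such that $$f(x_k+\alpha d_k)\le T_k+\sigma\alpha g_k^Td_k,$$ and set $x_{k+1}=x_k+\alpha_k d_k$. The sequence $\{x_k\}$ is understood to be infinite (the practical stopping test is disregarded). *)

theory Defs
  imports "HOL-Analysis.Analysis"
begin

text \<open>
  Throughout, \<open>F k\<close> stands for the function value \<open>f (x k)\<close> at the \<open>k\<close>-th iterate, \<open>\<eta>\<close> is the
  sequence of weights, \<open>N\<close> the memory bound and \<open>m\<close> the sequence of window lengths.
\<close>

text \<open>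
  Truncated subtraction does not interfere below: the indices occurring for \<open>k < N\<close> and
  \<open>k \<ge> N\<close> are all nonnegative, and the window lengths satisfy \<open>m k \<le> k\<close>.
\<close>

definition max_term :: "(nat \<Rightarrow> nat) \<Rightarrow> (nat \<Rightarrow> real) \<Rightarrow> nat \<Rightarrow> real" where
  "max_term m F k = Max ((\<lambda>j. F (k - j)) ` {0..m k})"

fun avg_term :: "nat \<Rightarrow> (nat \<Rightarrow> real) \<Rightarrow> (nat \<Rightarrow> real) \<Rightarrow> nat \<Rightarrow> real" where
  "avg_term N \<eta> F 0 = F 0"
| "avg_term N \<eta> F (Suc k) =
     (if Suc k < N then (1 - \<eta> k) * F (Suc k) + \<eta> k * avg_term N \<eta> F k
      else (\<Sum>j<N. (\<Prod>i=1..j. \<eta> (Suc k - i)) * (1 - \<eta> (Suc k - j - 1)) * F (Suc k - j))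
           + (\<Prod>i=1..N. \<eta> (Suc k - i)) * F (Suc k - N))"

datatype nm_variant = V1 | V2

definition nm_term ::
  "nm_variant \<Rightarrow> nat \<Rightarrow> (nat \<Rightarrow> real) \<Rightarrow> (nat \<Rightarrow> nat) \<Rightarrow> (nat \<Rightarrow> real) \<Rightarrow> nat \<Rightarrow> real" where
  "nm_term v N \<eta> m F k =
     (if k = 0 then F 0
      else if k < N then
        (case v of
           V1 \<Rightarrow> F k + \<eta> (k - 1) * (avg_term N \<eta> F (k - 1) - F k)
         | V2 \<Rightarrow> max_term m F k)
      else max (avg_term N \<eta> F k) (F k))"

definition nmls_parameters ::
  "real \<Rightarrow> real \<Rightarrow> real \<Rightarrow> nat \<Rightarrow> (nat \<Rightarrow> real) \<Rightarrow> (nat \<Rightarrow> nat) \<Rightarrow> bool" where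
  "nmls_parameters \<rho> \<sigma> s N \<eta> m \<longleftrightarrow>
     0 < \<rho> \<and> \<rho> < 1 \<and> 0 < \<sigma> \<and> \<sigma> < 1/2 \<and> 0 < s \<and> s \<le> 1 \<and> 1 \<le> N \<and>
     (\<forall>k. 0 \<le> \<eta> k \<and> \<eta> k < 1) \<and>
     m 0 = 0 \<and> (\<forall>k. m (Suc k) \<le> min (m k + 1) N)"

text \<open>
  The step sizes \<open>s, \<rho> s, \<rho>\<^sup>2 s, \<dots>\<close> that pass the line search test at the point \<open>p\<close> with
  gradient \<open>g\<close>, direction \<open>d\<close> and reference value \<open>T\<close>.
\<close>

definition acceptable_steps ::
  "(real ^ 'n \<Rightarrow> real) \<Rightarrow> real \<Rightarrow> real \<Rightarrow> real \<Rightarrow> real \<Rightarrow> real ^ 'n \<Rightarrow> real ^ 'n \<Rightarrow> real ^ 'n \<Rightarrow> real set"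
where
  "acceptable_steps f \<rho> \<sigma> s T p g d =
     {a. (\<exists>i::nat. a = \<rho> ^ i * s) \<and> f (p + a *\<^sub>R d) \<le> T + \<sigma> * a * (g \<bullet> d)}"

text \<open>
  \<open>x\<close>, \<open>d\<close> and \<open>\<alpha>\<close> are the iterates, directions and step sizes of an infinite run of the
  algorithm on \<open>f\<close>, whose gradient is \<open>gf\<close>, with starting point \<open>x 0\<close>.
\<close>

definition nmls_run ::
  "(real ^ 'n \<Rightarrow> real) \<Rightarrow> (real ^ 'n \<Rightarrow> real ^ 'n) \<Rightarrow> nm_variant \<Rightarrow> real \<Rightarrow> real \<Rightarrow> real \<Rightarrow> nat \<Rightarrow>
   (nat \<Rightarrow> real) \<Rightarrow> (nat \<Rightarrow> nat) \<Rightarrow>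
   (nat \<Rightarrow> real ^ 'n) \<Rightarrow> (nat \<Rightarrow> real ^ 'n) \<Rightarrow> (nat \<Rightarrow> real) \<Rightarrow> bool" where
  "nmls_run f gf v \<rho> \<sigma> s N \<eta> m x d \<alpha> \<longleftrightarrow>
     nmls_parameters \<rho> \<sigma> s N \<eta> m \<and>
     (\<forall>k. gf (x k) \<bullet> d k < 0 \<and>
          (let A = acceptable_steps f \<rho> \<sigma> s (nm_term v N \<eta> m (\<lambda>i. f (x i)) k) (x k) (gf (x k)) (d k)
           in \<alpha> k \<in> A \<and> (\<forall>a\<in>A. a \<le> \<alpha> k)) \<and>
          x (Suc k) = x k + \<alpha> k *\<^sub>R d k)"

definition limit_point_of_seq :: "'a::topological_space \<Rightarrow> (nat \<Rightarrow> 'a) \<Rightarrow> bool" where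
  "limit_point_of_seq z x \<longleftrightarrow> (\<exists>r. strict_mono r \<and> (x \<circ> r) \<longlonglongrightarrow> z)"

definition local_maximum :: "('a::metric_space \<Rightarrow> real) \<Rightarrow> 'a \<Rightarrow> bool" where
  "local_maximum f z \<longleftrightarrow> (\<exists>e>0. \<forall>y\<in>ball z e. f y \<le> f z)"

end

theory Submission
  imports Defs
begin

text \<open>
  Write \<open>W k\<close> for the largest of the last \<open>N + 1\<close> function values up to step \<open>k\<close> (all of them if
  \<open>k < N\<close>).  Both choices of the nonmonotone term lie between the current value and this window
  maximum: \<open>F k \<le> T k \<le> W k\<close>.  The right inequality holds because the averaged term is a convex
  combination of values in the window (\<open>telescoping_weights\<close>, \<open>nm_term_le_window_max\<close>), the left
  one because every accepted step lands below the reference value (\<open>le_nm_term\<close>).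

  The left inequality bounds the step sizes from below.  A rejected trial step violates an
  Armijo condition relative to \<open>F k\<close>, which for an \<open>L\<close>-Lipschitz gradient forces the step to be
  longer than a fixed constant, provided that the segment stays where the Lipschitz estimate holds.
  Trial points may leave \<open>C\<close>, but all iterates lie in the compact level set, which has a uniform
  neighbourhood inside \<open>C\<close>, so leaving it also takes a step of a fixed minimal size.  Hence
  \<open>F (k + 1) \<le> W k - c |g k|\<^sup>2\<close> for some constant \<open>c > 0\<close>.

  The right inequality makes \<open>W\<close> nonincreasing, so it converges.  Among any \<open>N + 1\<close> consecutive
  steps one produces the maximum of the next window, and its decrease is at most the drop of
  \<open>W\<close> (\<open>window_max_refresh\<close>); so at least one gradient in each such block is small.  Since
  \<open>|g (k + 1)| \<le> (1 + L c2) |g k|\<close>, the last gradient of the block is small as well, and the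
  gradients tend to zero (\<open>window_decrease_tendsto_zero\<close>).

  For the limit points, the steps tend to zero with the gradients, so replacing each iterate of a
  subsequence converging to \<open>z\<close> by the maximiser of its window does not change the limit.  The
  values there are \<open>W k\<close>, which tend to \<open>f z\<close> while staying strictly above their limit.  So there
  are points arbitrarily close to \<open>z\<close> with larger values (\<open>limit_point_not_local_maximum\<close>).
\<close>

section \<open>Window maxima\<close>

text \<open>
  Truncated subtraction is intended: for \<open>k < N\<close> the window is all of \<open>{0..k}\<close>.
\<close>

definition window_max :: "nat \<Rightarrow> (nat \<Rightarrow> real) \<Rightarrow> nat \<Rightarrow> real" where
  "window_max N F k = Max (F ` {k - N..k})"

lemma window_max_upper: "k - N \<le> i \<Longrightarrow> i \<le> k \<Longrightarrow> F i \<le> window_max N F k"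
  unfolding window_max_def by (intro Max_ge) auto

lemma window_max_attained: "\<exists>i. k - N \<le> i \<and> i \<le> k \<and> window_max N F k = F i"
proof -
  have "Max (F ` {k - N..k}) \<in> F ` {k - N..k}"
    by (intro Max_in) auto
  then show ?thesis
    unfolding window_max_def image_iff by auto
qed

lemma window_max_antimono:
  assumes "\<And>k. F (Suc k) \<le> window_max N F k"
  shows "decseq (window_max N F)"
proof (rule decseq_SucI)
  fix k
  obtain i where i: "Suc k - N \<le> i" "i \<le> Suc k" "window_max N F (Suc k) = F i"
    using window_max_attained[of "Suc k" N F] by blast
  show "window_max N F (Suc k) \<le> window_max N F k"
  proof (cases "i = Suc k")
    case True
    then show ?thesis using i assms by simp
  next
    case False
    then show ?thesis using i window_max_upper[of k N i F] by simp
  qed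
qed

text \<open>
  The window at \<open>0\<close> is a single point, so this confines the iterates to the initial level set.
\<close>

lemma values_le_first_of_window_decrease:
  assumes "\<And>k. F (Suc k) \<le> window_max N F k"
  shows "F k \<le> F 0"
proof -
  have "F k \<le> window_max N F k"
    by (rule window_max_upper) auto
  also have "\<dots> \<le> window_max N F 0"
    using window_max_antimono[OF assms] by (simp add: decseqD)
  finally show ?thesis
    by (simp add: window_max_def)
qed

lemma window_max_convergent:
  assumes "\<And>k. F (Suc k) \<le> window_max N F k" and "\<And>k. B \<le> F k"
  obtains M where "window_max N F \<longlonglongrightarrow> M" "\<And>k. M \<le> window_max N F k"
proof -
  have "B \<le> window_max N F k" for k
    using assms(2)[of k] window_max_upper[of k N k F] by simp
  with window_max_antimono[of F N, OF assms(1)] show thesis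
    using decseq_convergent[of "window_max N F" B] that by metis
qed

text \<open>
  The windows at \<open>k\<close> and \<open>k + N + 1\<close> are disjoint, so the maximum of the later one is attained at
  a value produced after step \<open>k\<close>, and the decrease guaranteed when that value was produced is
  bounded by the difference of the two maxima.
\<close>

lemma window_max_refresh:
  assumes "\<And>k. F (Suc k) \<le> window_max N F k - e k" and "\<And>k. 0 \<le> e k"
  obtains i where "i \<le> N" "e (k + i) \<le> window_max N F k - window_max N F (k + Suc N)"
proof -
  obtain j where j: "k + Suc N - N \<le> j" "j \<le> k + Suc N" "window_max N F (k + Suc N) = F j"
    using window_max_attained[of "k + Suc N" N F] by blast
  define i where "i = j - Suc k"
  have ji: "j = Suc (k + i)" "i \<le> N"
    using j(1,2) by (auto simp: i_def)
  have "F (Suc l) \<le> window_max N F l" for l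
    using assms(1)[of l] assms(2)[of l] by linarith
  then have "decseq (window_max N F)"
    by (rule window_max_antimono)
  then have "window_max N F (k + i) \<le> window_max N F k"
    by (rule decseqD) simp
  then have "e (k + i) \<le> window_max N F k - window_max N F (k + Suc N)"
    using assms(1)[of "k + i"] j(3) ji(1) by simp
  with ji(2) show thesis
    using that by blast
qed

text \<open>
  The decrease controls \<open>G\<close> only at one uncontrolled position in each block of \<open>N + 1\<close> indices.  The
  growth condition transports that bound to the end of the block, at the price of the factor
  \<open>K ^ N\<close>.
\<close>

lemma window_decrease_tendsto_zero:
  assumes c: "0 < c" and K: "1 \<le> K"
    and decrease: "\<And>k. F (Suc k) \<le> window_max N F k - c * (G k)\<^sup>2"
    and growth: "\<And>k. G (Suc k) \<le> K * G k"
    and nonneg: "\<And>k. 0 \<le> G k" and lower: "\<And>k. B \<le> F k"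
  shows "G \<longlonglongrightarrow> 0"
proof -
  let ?W = "window_max N F"
  have "F (Suc k) \<le> ?W k" for k
    using decrease[of k] c by (smt (verit) mult_nonneg_nonneg zero_le_power2)
  then obtain M where M: "?W \<longlonglongrightarrow> M"
    using window_max_convergent lower by blast
  have growth_iter: "G (k + n) \<le> K ^ n * G k" for k n
  proof (induction n)
    case (Suc n)
    have "G (k + Suc n) \<le> K * G (k + n)"
      using growth[of "k + n"] by simp
    also have "\<dots> \<le> K * (K ^ n * G k)"
      using Suc K by (intro mult_left_mono) auto
    finally show ?case by (simp add: mult.assoc)
  qed simp
  have bound: "(G (k + N))\<^sup>2 \<le> (K ^ N)\<^sup>2 / c * (?W k - ?W (k + Suc N))" for k
  proof -
    obtain i where i: "i \<le> N" "c * (G (k + i))\<^sup>2 \<le> ?W k - ?W (k + Suc N)"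
    proof (rule window_max_refresh[of F N "\<lambda>k. c * (G k)\<^sup>2" k])
      show "F (Suc k) \<le> ?W k - c * (G k)\<^sup>2" for k
        by (rule decrease)
      show "0 \<le> c * (G k)\<^sup>2" for k
        using c by simp
    qed
    have "G (k + N) \<le> K ^ (N - i) * G (k + i)"
      using growth_iter[of "k + i" "N - i"] i(1) by simp
    also have "\<dots> \<le> K ^ N * G (k + i)"
      using K nonneg by (intro mult_right_mono power_increasing) auto
    finally have "(G (k + N))\<^sup>2 \<le> (K ^ N * G (k + i))\<^sup>2"
      using nonneg by (intro power_mono) auto
    also have "\<dots> = (K ^ N)\<^sup>2 / c * (c * (G (k + i))\<^sup>2)"
      using c by (simp add: power_mult_distrib)
    also have "\<dots> \<le> (K ^ N)\<^sup>2 / c * (?W k - ?W (k + Suc N))"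
      using i(2) c by (intro mult_left_mono) auto
    finally show ?thesis .
  qed
  have "(\<lambda>k. (K ^ N)\<^sup>2 / c * (?W k - ?W (k + Suc N))) \<longlonglongrightarrow> (K ^ N)\<^sup>2 / c * (M - M)"
    by (intro tendsto_intros M LIMSEQ_ignore_initial_segment)
  then have "(\<lambda>k. (K ^ N)\<^sup>2 / c * (?W k - ?W (k + Suc N))) \<longlonglongrightarrow> 0"
    by simp
  then have "(\<lambda>k. (G (k + N))\<^sup>2) \<longlonglongrightarrow> 0"
    by (rule Lim_null_comparison[rotated]) (use bound in simp)
  then have "(\<lambda>k. sqrt ((G (k + N))\<^sup>2)) \<longlonglongrightarrow> sqrt 0"
    by (rule tendsto_real_sqrt)
  then have "(\<lambda>k. G (k + N)) \<longlonglongrightarrow> 0"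
    using nonneg by simp
  then show ?thesis
    by (rule LIMSEQ_offset)
qed

section \<open>Limit points of sequences with vanishing steps\<close>

text \<open>
  Each distance is at most one summand of a sum of \<open>N + 1\<close> sequences, one for every possible
  offset \<open>k - l k\<close>, and each of these sequences tends to zero.
\<close>

lemma vanishing_steps_window:
  fixes x :: "nat \<Rightarrow> 'a::metric_space"
  assumes steps: "(\<lambda>k. dist (x (Suc k)) (x k)) \<longlonglongrightarrow> 0"
    and window: "\<And>k. k - N \<le> l k" "\<And>k. l k \<le> k"
  shows "(\<lambda>k. dist (x (l k)) (x k)) \<longlonglongrightarrow> 0"
proof -
  have fixed_shift: "(\<lambda>i. dist (x i) (x (i + n))) \<longlonglongrightarrow> 0" for n
  proof (induction n)
    case (Suc n)
    have "(\<lambda>i. dist (x i) (x (i + n)) + dist (x (Suc (i + n))) (x (i + n))) \<longlonglongrightarrow> 0 + 0"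
      using Suc LIMSEQ_ignore_initial_segment[OF steps, of n] by (intro tendsto_add) auto
    then have "(\<lambda>i. dist (x i) (x (i + n)) + dist (x (Suc (i + n))) (x (i + n))) \<longlonglongrightarrow> 0"
      by simp
    then show ?case
    proof (rule Lim_null_comparison[rotated, OF _ always_eventually], intro allI)
      show "norm (dist (x i) (x (i + Suc n))) \<le> dist (x i) (x (i + n)) + dist (x (Suc (i + n))) (x (i + n))" for i
        using dist_triangle[of "x i" "x (i + Suc n)" "x (i + n)"] by (simp add: dist_commute)
    qed
  qed simp
  define E where "E i = (\<Sum>n\<le>N. dist (x i) (x (i + n)))" for i
  have "E \<longlonglongrightarrow> 0"
    unfolding E_def by (intro tendsto_null_sum fixed_shift)
  moreover have "filterlim l sequentially sequentially"
  proof (rule filterlim_at_top_mono)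
    show "filterlim (\<lambda>k. k - N) sequentially sequentially"
      by (rule filterlim_minus_const_nat_at_top)
  qed (use window in auto)
  ultimately have lim: "(\<lambda>k. E (l k)) \<longlonglongrightarrow> 0"
    by (rule filterlim_compose)
  have "dist (x (l k)) (x k) \<le> E (l k)" for k
  proof -
    have "k - l k \<in> {..N}" "l k + (k - l k) = k"
      using window[of k] by auto
    then show ?thesis
      unfolding E_def using member_le_sum[of "k - l k" "{..N}" "\<lambda>n. dist (x (l k)) (x (l k + n))"]
      by auto
  qed
  then show ?thesis
    by (intro Lim_null_comparison[OF _ lim] always_eventually allI) simp
qed

text \<open>
  Strict decrease below the window maximum makes the maxima fall strictly over \<open>N + 1\<close> steps, hence
  exceed their limit \<open>M\<close>.  They are values of \<open>f\<close> at window maximisers, which accumulate at \<open>z\<close>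
  along with the iterates; by continuity \<open>M = f z\<close>, so \<open>f\<close> is larger than \<open>f z\<close> near \<open>z\<close>.
\<close>

lemma limit_point_not_local_maximum:
  fixes f :: "'a::metric_space \<Rightarrow> real"
  assumes steps: "(\<lambda>k. dist (x (Suc k)) (x k)) \<longlonglongrightarrow> 0"
    and decrease: "\<And>k. f (x (Suc k)) < window_max N (\<lambda>i. f (x i)) k"
    and lower: "\<And>k. B \<le> f (x k)"
    and cont: "isCont f z" and limit: "limit_point_of_seq z x"
  shows "\<not> local_maximum f z"
proof
  assume "local_maximum f z"
  then obtain e where e: "e > 0" "\<And>y. y \<in> ball z e \<Longrightarrow> f y \<le> f z"
    unfolding local_maximum_def by auto
  let ?F = "\<lambda>i. f (x i)"
  let ?W = "window_max N ?F"
  have weak: "?F (Suc k) \<le> ?W k" for k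
    using decrease[of k] by simp
  obtain M where M: "?W \<longlonglongrightarrow> M" "\<And>k. M \<le> ?W k"
    using window_max_convergent[of ?F N B] weak lower by blast
  have above: "M < ?W k" for k
  proof -
    (* the deficit W k - F (k + 1) itself serves as the guaranteed decrease *)
    obtain i where "?W (k + i) - ?F (Suc (k + i)) \<le> ?W k - ?W (k + Suc N)"
    proof (rule window_max_refresh[of ?F N "\<lambda>k. ?W k - ?F (Suc k)" k])
      show "?F (Suc k) \<le> ?W k - (?W k - ?F (Suc k))" for k
        by simp
      show "0 \<le> ?W k - ?F (Suc k)" for k
        using weak by simp
    qed
    then show ?thesis
      using decrease[of "k + i"] M(2)[of "k + Suc N"] by linarith
  qed
  have "\<forall>k. \<exists>i. k - N \<le> i \<and> i \<le> k \<and> ?W k = ?F i"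
    by (intro allI window_max_attained)
  then obtain l where l: "\<And>k. k - N \<le> l k" "\<And>k. l k \<le> k" "\<And>k. ?W k = ?F (l k)"
    by metis
  obtain r where r: "strict_mono r" "(x \<circ> r) \<longlonglongrightarrow> z"
    using limit unfolding limit_point_of_seq_def by blast
  have sub: "filterlim r sequentially sequentially"
    by (rule filterlim_subseq) (rule r)
  have "(\<lambda>i. dist (x (l (r i))) (x (r i))) \<longlonglongrightarrow> 0"
    by (rule filterlim_compose[OF vanishing_steps_window[OF steps l(1,2)] sub])
  moreover have "(\<lambda>i. dist (x (r i)) z) \<longlonglongrightarrow> 0"
    using r(2) by (subst (asm) tendsto_dist_iff) (simp add: o_def)
  ultimately have "(\<lambda>i. dist (x (l (r i))) (x (r i)) + dist (x (r i)) z) \<longlonglongrightarrow> 0"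
    by (rule tendsto_add_zero)
  then have "(\<lambda>i. dist (x (l (r i))) z) \<longlonglongrightarrow> 0"
    by (rule Lim_null_comparison[rotated]) (simp add: dist_triangle)
  then have lim: "(\<lambda>i. x (l (r i))) \<longlonglongrightarrow> z"
    by (subst tendsto_dist_iff)
  have "(\<lambda>i. ?W (r i)) \<longlonglongrightarrow> f z"
    unfolding l(3) by (rule isCont_tendsto_compose[OF cont lim])
  moreover have "(\<lambda>i. ?W (r i)) \<longlonglongrightarrow> M"
    by (rule filterlim_compose[OF M(1) sub])
  ultimately have fz: "f z = M"
    by (rule LIMSEQ_unique)
  have "eventually (\<lambda>i. x (l (r i)) \<in> ball z e) sequentially"
    using lim e(1) by (intro topological_tendstoD) auto
  then obtain i where "x (l (r i)) \<in> ball z e"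
    by (auto simp: eventually_sequentially)
  then show False
    using e(2) above[of "r i"] fz l(3) by force
qed

section \<open>The nonmonotone terms\<close>

text \<open>
  With \<open>a i = \<eta> (k - i)\<close> these are the weights in the averaged term; together with their
  nonnegativity, this makes it a convex combination.
\<close>

lemma telescoping_weights:
  fixes a :: "nat \<Rightarrow> 'a::comm_ring_1"
  shows "(\<Sum>j<n. (\<Prod>i=1..j. a i) * (1 - a (Suc j))) + (\<Prod>i=1..n. a i) = 1"
  by (induction n) (auto simp: algebra_simps)

lemma avg_term_le:
  assumes \<eta>: "\<And>k. 0 \<le> \<eta> k" "\<And>k. \<eta> k \<le> 1"
    and bound: "\<And>i. k - N \<le> i \<Longrightarrow> i \<le> k \<Longrightarrow> F i \<le> B"
  shows "avg_term N \<eta> F k \<le> B"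
  using bound
proof (induction k)
  case (Suc k)
  show ?case
  proof (cases "Suc k < N")
    case True
    have "avg_term N \<eta> F k \<le> B" "F (Suc k) \<le> B"
      using True by (auto intro!: Suc)
    then have "(1 - \<eta> k) * F (Suc k) + \<eta> k * avg_term N \<eta> F k \<le> (1 - \<eta> k) * B + \<eta> k * B"
      using \<eta> by (intro add_mono mult_left_mono) auto
    then show ?thesis
      using True by (simp add: algebra_simps)
  next
    case False
    let ?a = "\<lambda>i. \<eta> (Suc k - i)"
    have "avg_term N \<eta> F (Suc k) =
        (\<Sum>j<N. (\<Prod>i=1..j. ?a i) * (1 - ?a (Suc j)) * F (Suc k - j)) + (\<Prod>i=1..N. ?a i) * F (Suc k - N)"
      using False by simp
    also have "\<dots> \<le> (\<Sum>j<N. (\<Prod>i=1..j. ?a i) * (1 - ?a (Suc j)) * B) + (\<Prod>i=1..N. ?a i) * B"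
      using \<eta> by (intro add_mono sum_mono mult_left_mono mult_nonneg_nonneg prod_nonneg Suc.prems) auto
    also have "\<dots> = ((\<Sum>j<N. (\<Prod>i=1..j. ?a i) * (1 - ?a (Suc j))) + (\<Prod>i=1..N. ?a i)) * B"
      by (simp add: sum_distrib_right distrib_right)
    also have "\<dots> = B"
      by (simp only: telescoping_weights[of ?a N] mult_1)
    finally show ?thesis .
  qed
qed simp

text \<open>
  During start-up the first variant is the recursion of the averaged term, written with the
  convex combination rearranged.
\<close>

lemma nm_term_V1_eq_avg_term:
  "k < N \<Longrightarrow> nm_term V1 N \<eta> m F k = avg_term N \<eta> F k"
  by (cases k) (auto simp: nm_term_def algebra_simps)

text \<open>
  The window of the max-type term has length \<open>m k \<le> min k N\<close>, so it is contained in the one over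
  which \<open>window_max\<close> is taken; the averaged term is covered by \<open>avg_term_le\<close>.
\<close>

lemma nm_term_le_window_max:
  assumes "nmls_parameters \<rho> \<sigma> s N \<eta> m"
  shows "nm_term v N \<eta> m F k \<le> window_max N F k"
proof -
  have \<eta>: "\<And>k. 0 \<le> \<eta> k" "\<And>k. \<eta> k \<le> 1"
    using assms by (auto simp: nmls_parameters_def less_imp_le)
  have m: "m j \<le> j \<and> m j \<le> N" for j
  proof (induction j)
    case (Suc j)
    have "m (Suc j) \<le> min (m j + 1) N"
      using assms by (simp add: nmls_parameters_def)
    then show ?case using Suc by auto
  qed (use assms in \<open>auto simp: nmls_parameters_def\<close>)
  have avg: "avg_term N \<eta> F k \<le> window_max N F k"
    by (rule avg_term_le) (auto simp: \<eta> intro: window_max_upper)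
  have now: "F k \<le> window_max N F k"
    by (rule window_max_upper) auto
  have max: "max_term m F k \<le> window_max N F k"
    unfolding max_term_def
    using m[of k] by (auto intro!: Max.boundedI window_max_upper)
  show ?thesis
  proof (cases "k < N")
    case True
    then show ?thesis
      using avg now max nm_term_V1_eq_avg_term[OF True, of \<eta> m F]
      by (cases v) (auto simp: nm_term_def)
  next
    case False
    then show ?thesis
      using avg now by (auto simp: nm_term_def)
  qed
qed

text \<open>
  Only the start-up phase of the first variant is not immediate.  There the term is a convex
  combination of \<open>F k\<close> and the previous reference value, and \<open>F k\<close> was accepted below the latter.
\<close>

lemma le_nm_term:
  assumes \<eta>: "\<And>k. 0 \<le> \<eta> k"
    and accepted: "\<And>k. F (Suc k) \<le> nm_term v N \<eta> m F k"
  shows "F k \<le> nm_term v N \<eta> m F k"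
proof (cases "0 < k \<and> k < N")
  case True
  then obtain j where j: "k = Suc j"
    by (cases k) auto
  show ?thesis
  proof (cases v)
    case V1
    have "F k \<le> avg_term N \<eta> F (k - 1)"
      using accepted[of j] nm_term_V1_eq_avg_term[of j N \<eta> m F] V1 True j by simp
    then have "0 \<le> \<eta> (k - 1) * (avg_term N \<eta> F (k - 1) - F k)"
      using \<eta> by simp
    then show ?thesis
      using True V1 by (simp add: nm_term_def)
  next
    case V2
    have "F (k - 0) \<le> max_term m F k"
      unfolding max_term_def by (intro Max_ge imageI) auto
    then show ?thesis
      using True V2 by (simp add: nm_term_def)
  qed
qed (auto simp: nm_term_def)

section \<open>Step sizes\<close>

lemma gradient_mean_value:
  fixes f :: "'a::real_inner \<Rightarrow> real"
  assumes grad: "\<And>y. GDERIV f y :> gf y" and "0 < t"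
  obtains u where "0 < u" "u < t" "f (p + t *\<^sub>R d) = f p + t * (gf (p + u *\<^sub>R d) \<bullet> d)"
proof -
  let ?\<phi> = "\<lambda>u. f (p + u *\<^sub>R d)"
  have "(?\<phi> has_derivative (\<lambda>h. (h *\<^sub>R d) \<bullet> gf (p + u *\<^sub>R d))) (at u within {0..t})" for u
  proof -
    have "(f has_derivative (\<lambda>h. h \<bullet> gf (p + u *\<^sub>R d))) (at (p + u *\<^sub>R d))"
      using grad by (simp add: gderiv_def)
    moreover have "((\<lambda>u. p + u *\<^sub>R d) has_derivative (\<lambda>h. h *\<^sub>R d)) (at u within {0..t})"
      by (auto intro!: derivative_eq_intros)
    ultimately show ?thesis
      by (rule has_derivative_compose[rotated])
  qed
  from mvt_simple[OF \<open>0 < t\<close>, of ?\<phi> "\<lambda>u h. (h *\<^sub>R d) \<bullet> gf (p + u *\<^sub>R d)", OF this]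
  obtain u where "u \<in> {0<..<t}" "f (p + t *\<^sub>R d) - f p = (t *\<^sub>R d) \<bullet> gf (p + u *\<^sub>R d)"
    by auto
  then show thesis
    by (intro that[of u]) (auto simp: inner_commute)
qed

text \<open>
  By the mean value theorem the actual change exceeds the linear prediction by at most
  \<open>L t\<^sup>2 |d|\<^sup>2\<close>.  Rejection says that the excess is more than \<open>(1 - \<sigma>) t |g \<bullet> d|\<close>; the descent
  condition bounds the latter from below and the length condition bounds \<open>|d|\<close> from above by
  multiples of \<open>|g|\<close>, which then cancels.
\<close>

lemma rejected_step_bound:
  fixes f :: "'a::real_inner \<Rightarrow> real"
  assumes grad: "\<And>y. GDERIV f y :> gf y"
    and "0 < t" "0 < L" "0 < c2"
    and lip: "\<And>y. y \<in> cball p \<delta> \<Longrightarrow> norm (gf y - gf p) \<le> L * norm (y - p)"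
    and near: "t * norm d \<le> \<delta>"
    and rejected: "f p + \<sigma> * t * (gf p \<bullet> d) < f (p + t *\<^sub>R d)" and "\<sigma> < 1"
    and descent: "gf p \<bullet> d \<le> - c1 * (norm (gf p))\<^sup>2"
    and direction: "norm d \<le> c2 * norm (gf p)" and nz: "gf p \<noteq> 0"
  shows "(1 - \<sigma>) * c1 / (L * c2\<^sup>2) \<le> t"
proof -
  obtain u where u: "0 < u" "u < t" "f (p + t *\<^sub>R d) = f p + t * (gf (p + u *\<^sub>R d) \<bullet> d)"
    using gradient_mean_value[OF grad \<open>0 < t\<close>] by blast
  have ud: "u * norm d \<le> t * norm d"
    using u by (intro mult_right_mono) auto
  have "norm (gf (p + u *\<^sub>R d) - gf p) \<le> L * (u * norm d)"
    using lip[of "p + u *\<^sub>R d"] ud near u by (simp add: dist_norm)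
  also have "\<dots> \<le> L * (t * norm d)"
    using ud \<open>0 < L\<close> by simp
  finally have "(gf (p + u *\<^sub>R d) - gf p) \<bullet> d \<le> L * (t * norm d) * norm d"
    by (intro order_trans[OF norm_cauchy_schwarz] mult_right_mono) auto
  then have upper: "gf (p + u *\<^sub>R d) \<bullet> d \<le> gf p \<bullet> d + L * t * (norm d)\<^sup>2"
    by (simp add: inner_diff_left power2_eq_square algebra_simps)
  have "t * (\<sigma> * (gf p \<bullet> d)) < t * (gf (p + u *\<^sub>R d) \<bullet> d)"
    using rejected u(3) by (simp add: algebra_simps)
  then have "\<sigma> * (gf p \<bullet> d) < gf (p + u *\<^sub>R d) \<bullet> d"
    using \<open>0 < t\<close> by simp
  with upper have "(1 - \<sigma>) * - (gf p \<bullet> d) \<le> L * t * (norm d)\<^sup>2"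
    by (simp add: algebra_simps)
  moreover have "(1 - \<sigma>) * (c1 * (norm (gf p))\<^sup>2) \<le> (1 - \<sigma>) * - (gf p \<bullet> d)"
    using descent \<open>\<sigma> < 1\<close> by (intro mult_left_mono) auto
  moreover have "L * t * (norm d)\<^sup>2 \<le> L * t * (c2 * norm (gf p))\<^sup>2"
    using direction \<open>0 < L\<close> \<open>0 < t\<close> by (intro mult_left_mono power_mono) auto
  ultimately have "((1 - \<sigma>) * c1) * (norm (gf p))\<^sup>2 \<le> (t * (L * c2\<^sup>2)) * (norm (gf p))\<^sup>2"
    by (simp add: power_mult_distrib mult_ac)
  then have "(1 - \<sigma>) * c1 \<le> t * (L * c2\<^sup>2)"
    using nz by simp
  then show ?thesis
    using \<open>0 < L\<close> \<open>0 < c2\<close> by (simp add: divide_le_eq)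
qed

text \<open>
  Unless the first trial step \<open>s\<close> is accepted, the trial step \<open>\<alpha> / \<rho>\<close> was rejected.  Either it
  moved less than \<open>\<delta>\<close>, so that \<open>rejected_step_bound\<close> applies, or it moved farther, which takes a
  step of at least \<open>\<delta> / D\<close> because \<open>D\<close> bounds the length of the direction.
\<close>

lemma accepted_step_bound:
  fixes f :: "real ^ 'n \<Rightarrow> real"
  assumes grad: "\<And>y. GDERIV f y :> gf y"
    and pos: "0 < \<rho>" "\<rho> < 1" "0 < s" "0 < L" "0 < c2" and "\<sigma> < 1"
    and accepted: "\<alpha> \<in> acceptable_steps f \<rho> \<sigma> s T p (gf p) d"
    and largest: "\<And>a. a \<in> acceptable_steps f \<rho> \<sigma> s T p (gf p) d \<Longrightarrow> a \<le> \<alpha>"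
    and reference: "f p \<le> T"
    and lip: "\<And>y. y \<in> cball p \<delta> \<Longrightarrow> norm (gf y - gf p) \<le> L * norm (y - p)"
    and descent: "gf p \<bullet> d \<le> - c1 * (norm (gf p))\<^sup>2"
    and direction: "norm d \<le> c2 * norm (gf p)" "norm d \<le> D" and "0 < D" and nz: "gf p \<noteq> 0"
  shows "min s (\<rho> * min (\<delta> / D) ((1 - \<sigma>) * c1 / (L * c2\<^sup>2))) \<le> \<alpha>"
proof -
  obtain i where i: "\<alpha> = \<rho> ^ i * s"
    using accepted by (auto simp: acceptable_steps_def)
  show ?thesis
  proof (cases i)
    case 0
    then show ?thesis using i by simp
  next
    case (Suc j)
    (* the trial step tested immediately before the accepted one *)
    define t where "t = \<rho> ^ j * s"
    have t: "0 < t" "\<alpha> = \<rho> * t"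
      using pos i Suc by (auto simp: t_def)
    have "\<alpha> < t"
      using t pos by simp
    then have "t \<notin> acceptable_steps f \<rho> \<sigma> s T p (gf p) d"
      using largest by force
    then have "T + \<sigma> * t * (gf p \<bullet> d) < f (p + t *\<^sub>R d)"
      unfolding acceptable_steps_def t_def by auto
    then have rejected: "f p + \<sigma> * t * (gf p \<bullet> d) < f (p + t *\<^sub>R d)"
      using reference by linarith
    have "min (\<delta> / D) ((1 - \<sigma>) * c1 / (L * c2\<^sup>2)) \<le> t"
    proof (cases "t * norm d \<le> \<delta>")
      case True
      have "(1 - \<sigma>) * c1 / (L * c2\<^sup>2) \<le> t"
        by (rule rejected_step_bound[OF grad _ _ _ lip True rejected _ descent direction(1) nz])
          (use t pos \<open>\<sigma> < 1\<close> in auto)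
      then show ?thesis by simp
    next
      case False
      moreover have "t * norm d \<le> t * D"
        using direction(2) t by simp
      ultimately have "\<delta> / D \<le> t"
        using \<open>0 < D\<close> by (simp add: divide_le_eq)
      then show ?thesis by simp
    qed
    then show ?thesis
      using t(2) pos(1) by (simp add: min.coboundedI2)
  qed
qed

section \<open>Global convergence\<close>

theorem theorem6:
  fixes f :: "real ^ 'n \<Rightarrow> real"
    and gf :: "real ^ 'n \<Rightarrow> real ^ 'n"
    and v :: nm_variant
    and \<rho> \<sigma> s :: real
    and N :: nat
    and \<eta> :: "nat \<Rightarrow> real"
    and m :: "nat \<Rightarrow> nat"
    and x d :: "nat \<Rightarrow> real ^ 'n"
    and \<alpha> :: "nat \<Rightarrow> real"
    and C :: "(real ^ 'n) set"
    and L c1 c2 :: real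
  assumes f_bounded: "bounded (range f)"
    and f_gradient: "\<forall>y. GDERIV f y :> gf y"
    and f_C1: "continuous_on UNIV gf"
    and run: "nmls_run f gf v \<rho> \<sigma> s N \<eta> m x d \<alpha>"
    and level_bounded: "bounded {y. f y \<le> f (x 0)}"
    and C_open: "open C"
    and C_convex: "convex C"
    and C_level: "{y. f y \<le> f (x 0)} \<subseteq> C"
    and L_pos: "0 < L"
    and lipschitz: "\<forall>y\<in>C. \<forall>z\<in>C. norm (gf y - gf z) \<le> L * norm (y - z)"
    and c1: "0 < c1" "c1 < 1"
    and c2: "1 < c2"
    and descent: "\<forall>k. gf (x k) \<bullet> d k \<le> - c1 * (norm (gf (x k)))\<^sup>2"
    and direction_bound: "\<forall>k. norm (d k) \<le> c2 * norm (gf (x k))"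
  shows "(\<lambda>k. norm (gf (x k))) \<longlonglongrightarrow> 0 \<and>
         (\<forall>z. limit_point_of_seq z x \<longrightarrow> \<not> local_maximum f z)"
proof -
  define F where "F = (\<lambda>k. f (x k))"
  define g where "g = (\<lambda>k. gf (x k))"
  define T where "T = nm_term v N \<eta> m F"
  have params: "nmls_parameters \<rho> \<sigma> s N \<eta> m"
    using run by (simp add: nmls_run_def)
  then have par: "0 < \<rho>" "\<rho> < 1" "0 < \<sigma>" "\<sigma> < 1" "0 < s" "s \<le> 1" "\<And>k. 0 \<le> \<eta> k"
    by (auto simp: nmls_parameters_def)
  have slope: "g k \<bullet> d k < 0"
    and accepted: "\<alpha> k \<in> acceptable_steps f \<rho> \<sigma> s (T k) (x k) (gf (x k)) (d k)"
    and largest: "\<And>a. a \<in> acceptable_steps f \<rho> \<sigma> s (T k) (x k) (gf (x k)) (d k) \<Longrightarrow> a \<le> \<alpha> k"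
    and next_iterate: "x (Suc k) = x k + \<alpha> k *\<^sub>R d k" for k
    using run by (auto simp: nmls_run_def Let_def F_def g_def T_def)
  have nz: "g k \<noteq> 0" for k
    using slope[of k] by auto
  have grad: "GDERIV f y :> gf y" for y
    using f_gradient by simp
  have cont: "isCont f y" for y
    using grad[of y] unfolding gderiv_def by (rule has_derivative_continuous)

  have \<alpha>_range: "0 < \<alpha> k" "\<alpha> k \<le> 1" for k
  proof -
    obtain i where i: "\<alpha> k = \<rho> ^ i * s"
      using accepted[of k] by (auto simp: acceptable_steps_def)
    show "0 < \<alpha> k"
      using i par by simp
    have "\<rho> ^ i * s \<le> 1 * 1"
      using par by (intro mult_mono power_le_one) auto
    then show "\<alpha> k \<le> 1"
      using i by simp
  qed
  have line_search: "F (Suc k) \<le> T k + \<sigma> * \<alpha> k * (g k \<bullet> d k)" for k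
    using accepted[of k] next_iterate[of k] by (auto simp: acceptable_steps_def F_def g_def)
  have F_less_T: "F (Suc k) < T k" for k
  proof -
    have "\<sigma> * \<alpha> k * (g k \<bullet> d k) < 0"
      using slope[of k] \<alpha>_range(1)[of k] par by (intro mult_pos_neg) auto
    then show ?thesis
      using line_search[of k] by linarith
  qed
  have T_le: "T k \<le> window_max N F k" for k
    unfolding T_def by (rule nm_term_le_window_max[OF params])
  have F_less_W: "F (Suc k) < window_max N F k" for k
    using F_less_T[of k] T_le[of k] by linarith
  have F_le_T: "F k \<le> T k" for k
    unfolding T_def
    by (rule le_nm_term) (use par F_less_T in \<open>auto simp: T_def less_imp_le\<close>)
  obtain B where B: "\<And>y. norm (f y) \<le> B"
    using f_bounded by (auto simp: bounded_iff)
  have lower: "- B \<le> F k" for k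
    using B[of "x k"] by (simp add: F_def abs_le_iff)

  let ?S = "{y. f y \<le> f (x 0)}"
  have in_level: "x k \<in> ?S" for k
    using values_le_first_of_window_decrease[of F N k] F_less_W by (simp add: F_def less_imp_le)
  have in_C: "x k \<in> C" for k
    using in_level C_level by blast
  have "closed ?S"
    using cont by (intro closed_Collect_le continuous_at_imp_continuous_on continuous_intros) auto
  then have compact: "compact ?S"
    using level_bounded by (simp add: compact_eq_bounded_closed)
  (* trial points closer than this to an iterate cannot leave the region of the Lipschitz estimate *)
  obtain \<delta> where \<delta>: "0 < \<delta>" "(\<Union>y\<in>?S. cball y \<delta>) \<subseteq> C"
    using compact_subset_open_imp_cball_epsilon_subset[OF compact C_open C_level] by blast
  have "bounded (gf ` ?S)"
    by (intro compact_imp_bounded compact_continuous_image compact continuous_on_subset[OF f_C1]) auto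
  then obtain G where G: "0 < G" "\<And>k. norm (g k) \<le> G"
    using in_level unfolding bounded_pos g_def by blast

  (* c2 * G bounds the length of every direction, so a does not depend on k *)
  define a where "a = min s (\<rho> * min (\<delta> / (c2 * G)) ((1 - \<sigma>) * c1 / (L * c2\<^sup>2)))"
  have a_pos: "0 < a"
    unfolding a_def using par \<delta>(1) G(1) c1 c2 L_pos by auto
  have a_le: "a \<le> \<alpha> k" for k
    unfolding a_def
  proof (rule accepted_step_bound[OF grad _ _ _ _ _ _ accepted largest])
    show "f (x k) \<le> T k"
      using F_le_T by (simp add: F_def)
    show "norm (gf y - gf (x k)) \<le> L * norm (y - x k)" if "y \<in> cball (x k) \<delta>" for y
      using lipschitz in_C that \<delta>(2) in_level by blast
    have "norm (d k) \<le> c2 * norm (g k)"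
      using direction_bound by (simp add: g_def)
    also have "\<dots> \<le> c2 * G"
      using G(2) c2 by simp
    finally show "norm (d k) \<le> c2 * G" .
  qed (use par L_pos c2 G descent direction_bound nz in \<open>auto simp: g_def\<close>)

  have decrease: "F (Suc k) \<le> window_max N F k - \<sigma> * a * c1 * (norm (g k))\<^sup>2" for k
  proof -
    have "c1 * (norm (g k))\<^sup>2 \<le> - (g k \<bullet> d k)"
      using spec[OF descent, of k] by (simp add: g_def)
    then have "\<sigma> * a * (c1 * (norm (g k))\<^sup>2) \<le> \<sigma> * \<alpha> k * - (g k \<bullet> d k)"
      using a_le[of k] a_pos par c1 by (intro mult_mono) auto
    then show ?thesis
      using line_search[of k] T_le[of k] by simp
  qed
  have step: "norm (x (Suc k) - x k) \<le> c2 * norm (g k)" for k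
  proof -
    have "norm (x (Suc k) - x k) = \<alpha> k * norm (d k)"
      using next_iterate[of k] \<alpha>_range(1)[of k] by simp
    also have "\<dots> \<le> 1 * norm (d k)"
      using \<alpha>_range(2) by (intro mult_right_mono) auto
    also have "\<dots> \<le> c2 * norm (g k)"
      using direction_bound by (simp add: g_def)
    finally show ?thesis .
  qed
  (* steps are at most 1 because s is, so consecutive gradients are comparable *)
  have growth: "norm (g (Suc k)) \<le> (1 + L * c2) * norm (g k)" for k
  proof -
    have "norm (g (Suc k)) \<le> norm (g k) + norm (g (Suc k) - g k)"
      by (rule norm_triangle_sub)
    also have "norm (g (Suc k) - g k) \<le> L * norm (x (Suc k) - x k)"
      using lipschitz in_C by (simp add: g_def)
    also have "\<dots> \<le> L * (c2 * norm (g k))"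
      using step L_pos by simp
    finally show ?thesis
      by (simp add: algebra_simps)
  qed
  have gradient_limit: "(\<lambda>k. norm (g k)) \<longlonglongrightarrow> 0"
    by (rule window_decrease_tendsto_zero[OF _ _ decrease growth _ lower])
      (use par a_pos c1 c2 L_pos in auto)

  have "(\<lambda>k. c2 * norm (g k)) \<longlonglongrightarrow> 0"
    by (rule tendsto_mult_right_zero) (rule gradient_limit)
  then have steps: "(\<lambda>k. dist (x (Suc k)) (x k)) \<longlonglongrightarrow> 0"
    by (rule Lim_null_comparison[rotated]) (simp add: dist_norm step)
  have "\<not> local_maximum f z" if "limit_point_of_seq z x" for z
    by (rule limit_point_not_local_maximum[OF steps _ _ cont that])
      (use F_less_W lower in \<open>auto simp: F_def\<close>)
  with gradient_limit show ?thesis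
    by (simp add: g_def)
qed

end
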